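(* Let $(A,\mu,\Delta,\alpha)$ be a Hom-bialgebra over $\mathbf{k}$ and let $R\in\mathrm{Hom}(A^{\otimes 2},\mathbf{k})$ be a bilinear form on $A$. Define linear maps $\pi_1,\pi_1',\pi_2,\pi_2'\colon A\to A^*$ by $$\pi_1(x)=R(-\otimes\alpha(x)),\quad \pi_1'(x)=R(\alpha(-)\otimes x),\quad \pi_2(x)=R(\alpha(x)\otimes -),\quad \pi_2'(x)=R(x\otimes\alpha(-)).$$ Then the following statements are equivalent: (1) $R(\alpha(x)\otimes yz)=\sum R(x_1\otimes\alpha(z))R(x_2\otimes\alpha(y))$ for all $x,y,z\in A$; (2) $\pi_1'\circ\mu=\Delta^{*op}\circ(\pi_1\otimes\pi_1)$ as maps $A\otimes A\to A^*$, where $\Delta^{*op}=\Delta^*\circ\tau$. If $A$ is finite dimensional, then the two statements above are also equivalent to (3) $\mu^*\circ\pi_2=(\pi_2'\otimes\pi_2')\circ\Delta^{op}$ as maps $A\to A^*\otimes A^*$, where $\Delta^{op}=\tau\circ\Delta$.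
   Context: $\mathbf{k}$ is a field of characteristic $0$; tensor products and linear maps are over $\mathbf{k}$; $A^*=\mathrm{Hom}(A,\mathbf{k})$, $\langle\phi,v\rangle$ denotes $\phi(v)$, and $\tau(v\otimes w)=w\otimes v$. Write $\Delta(x)=\sum x_1\otimes x_2$ (Sweedler) and $xy=\mu(x,y)$. A Hom-bialgebra $(A,\mu,\Delta,\alpha)$ consists of a $\mathbf{k}$-module $A$, a bilinear map $\mu\colon A^{\otimes 2}\to A$, a linear map $\Delta\colon A\to A^{\otimes 2}$ and a linear map $\alpha\colon A\to A$ such that $\alpha\circ\mu=\mu\circ\alpha^{\otimes 2}$, $\mu\circ(\alpha\otimes\mu)=\mu\circ(\mu\otimes\alpha)$, $\alpha^{\otimes 2}\circ\Delta=\Delta\circ\alpha$, $(\alpha\otimes\Delta)\circ\Delta=(\Delta\otimes\alpha)\circ\Delta$, and $\Delta(ab)=\sum a_1b_1\otimes a_2b_2$ for all $a,b\in A$. No unit or counit is required. The map $\Delta^*\colon A^*\otimes A^*\to A^*$ is defined by $\langle\Delta^*(\phi,\psi),x\rangle=\langle\phi\otimes\psi,\Delta(x)\rangle$. When $A$ is finite dimensional, $\mu^*\colon A^*\to A^*\otimes A^*\cong(A\otimes A)^*$ is defined by $\langle\mu^*(\phi),x\otimes y\rangle=\langle\phi,\mu(x,y)\rangle$. *)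

theory Defs
  imports Complex_Main "HOL-Library.Function_Algebras"
begin

text \<open>
  A vector space over the field \<open>'k\<close> is given by a scalar multiplication on an ambient type and
  a subspace of that type. The subspace is needed for duals and tensor products, whose
  elements depend on the given scalar multiplications and so do not form a type of their own.
\<close>

record ('k, 'v) vspace =
  carr :: "'v set"
  smul :: "'k \<Rightarrow> 'v \<Rightarrow> 'v"

definition vspace :: "('k::field, 'v::ab_group_add) vspace \<Rightarrow> bool" where
  "vspace V \<longleftrightarrow> vector_space (smul V) \<and> module.subspace (smul V) (carr V)"

definition whole :: "('k \<Rightarrow> 'v \<Rightarrow> 'v) \<Rightarrow> ('k, 'v) vspace" where
  "whole scale = \<lparr>carr = UNIV, smul = scale\<rparr>"

definition scalars :: "('k::field, 'k) vspace" where
  "scalars = whole (*)"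

definition lin :: "('k::field, 'v::ab_group_add) vspace \<Rightarrow> ('k, 'w::ab_group_add) vspace
    \<Rightarrow> ('v \<Rightarrow> 'w) \<Rightarrow> bool" where
  "lin V W f \<longleftrightarrow>
     (\<forall>x\<in>carr V. f x \<in> carr W) \<and>
     (\<forall>x\<in>carr V. \<forall>y\<in>carr V. f (x + y) = f x + f y) \<and>
     (\<forall>c. \<forall>x\<in>carr V. f (smul V c x) = smul W c (f x))"

definition bilin :: "('k::field, 'v::ab_group_add) vspace \<Rightarrow> ('k, 'w::ab_group_add) vspace
    \<Rightarrow> ('k, 'u::ab_group_add) vspace \<Rightarrow> ('v \<Rightarrow> 'w \<Rightarrow> 'u) \<Rightarrow> bool" where
  "bilin V W U h \<longleftrightarrow>
     (\<forall>v\<in>carr V. lin W U (h v)) \<and> (\<forall>w\<in>carr W. lin V U (\<lambda>v. h v w))"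

definition smul_fun :: "'k::field \<Rightarrow> ('x \<Rightarrow> 'k) \<Rightarrow> 'x \<Rightarrow> 'k" where
  "smul_fun c f = (\<lambda>x. c * f x)"

text \<open>
  Functionals are required to vanish outside the carrier, so that a functional is determined by
  its restriction to the carrier.
\<close>

definition dual :: "('k::field, 'v::ab_group_add) vspace \<Rightarrow> ('k, 'v \<Rightarrow> 'k) vspace" where
  "dual V = \<lparr>carr = {f. lin V scalars f \<and> (\<forall>x. x \<notin> carr V \<longrightarrow> f x = 0)}, smul = smul_fun\<rparr>"

text \<open>
  The tensor product is constructed inside the dual of the space of bilinear forms on
  \<open>V \<times> W\<close>: the tensor \<open>v \<otimes> w\<close> is evaluation of bilinear forms at \<open>(v, w)\<close>, and \<open>V \<otimes> W\<close> is
  the span of these. The universal property, for arbitrary target spaces, is proved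
  below (\<open>tensor_universal\<close>, \<open>tensor_unique\<close>); all maps out of a tensor product are defined by it.
\<close>

definition tens :: "('k::field, 'v::ab_group_add) vspace \<Rightarrow> ('k, 'w::ab_group_add) vspace
    \<Rightarrow> 'v \<Rightarrow> 'w \<Rightarrow> ('v \<Rightarrow> 'w \<Rightarrow> 'k) \<Rightarrow> 'k" where
  "tens V W v w = (\<lambda>\<beta>. if bilin V W scalars \<beta> then \<beta> v w else 0)"

definition tensor :: "('k::field, 'v::ab_group_add) vspace \<Rightarrow> ('k, 'w::ab_group_add) vspace
    \<Rightarrow> ('k, ('v \<Rightarrow> 'w \<Rightarrow> 'k) \<Rightarrow> 'k) vspace" (infixr "\<otimes>" 75) where
  "V \<otimes> W = \<lparr>carr = module.span smul_fun {tens V W v w |v w. v \<in> carr V \<and> w \<in> carr W},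
            smul = smul_fun\<rparr>"

definition tensor_lift :: "('k::field, 'v::ab_group_add) vspace \<Rightarrow> ('k, 'w::ab_group_add) vspace
    \<Rightarrow> ('k, 'u::ab_group_add) vspace \<Rightarrow> ('v \<Rightarrow> 'w \<Rightarrow> 'u) \<Rightarrow> (('v \<Rightarrow> 'w \<Rightarrow> 'k) \<Rightarrow> 'k) \<Rightarrow> 'u" where
  "tensor_lift V W U h =
     (SOME f. lin (V \<otimes> W) U f \<and> (\<forall>v\<in>carr V. \<forall>w\<in>carr W. f (tens V W v w) = h v w))"

lemma vector_space_smul_fun: "vector_space (smul_fun :: 'k::field \<Rightarrow> ('x \<Rightarrow> 'k) \<Rightarrow> 'x \<Rightarrow> 'k)"
  by unfold_locales (auto simp: smul_fun_def fun_eq_iff algebra_simps)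

lemmas module_smul_fun = vector_space_smul_fun[folded module_iff_vector_space]

lemma vspace_whole: "vector_space scale \<Longrightarrow> vspace (whole scale)"
  by (simp add: vspace_def whole_def module.subspace_UNIV module_iff_vector_space)

lemma vspace_add: "vspace V \<Longrightarrow> x \<in> carr V \<Longrightarrow> y \<in> carr V \<Longrightarrow> x + y \<in> carr V"
  and vspace_smul: "vspace V \<Longrightarrow> x \<in> carr V \<Longrightarrow> smul V c x \<in> carr V"
  unfolding vspace_def module_iff_vector_space[symmetric]
  by (blast intro: module.subspace_add module.subspace_scale)+

lemma vspace_scalars: "vspace scalars"
  unfolding scalars_def by (rule vspace_whole) (unfold_locales, auto simp: algebra_simps)

lemma vspace_tensor: "vspace (V \<otimes> W)"
  unfolding vspace_def tensor_def vspace.simps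
  by (intro conjI vector_space_smul_fun module.subspace_span module_smul_fun)

lemma vspace_dual: "vspace (dual V)"
proof -
  interpret vector_space "smul_fun :: 'a \<Rightarrow> ('b \<Rightarrow> 'a) \<Rightarrow> 'b \<Rightarrow> 'a" by (rule vector_space_smul_fun)
  show ?thesis
    using vector_space_smul_fun
    by (auto simp: vspace_def dual_def subspace_def lin_def scalars_def whole_def smul_fun_def
        algebra_simps)
qed

lemma tens_in:
  fixes V :: "('k::field, 'v::ab_group_add) vspace" and W :: "('k, 'w::ab_group_add) vspace"
  assumes "v \<in> carr V" "w \<in> carr W"
  shows "tens V W v w \<in> carr (V \<otimes> W)"
proof -
  interpret vector_space "smul_fun :: 'k \<Rightarrow> (('v \<Rightarrow> 'w \<Rightarrow> 'k) \<Rightarrow> 'k) \<Rightarrow> ('v \<Rightarrow> 'w \<Rightarrow> 'k) \<Rightarrow> 'k"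
    by (rule vector_space_smul_fun)
  show ?thesis
    unfolding tensor_def vspace.simps by (rule span_base) (use assms in blast)
qed

lemma tensor_induct [consumes 1, case_names zero step]:
  fixes V :: "('k::field, 'v::ab_group_add) vspace" and W :: "('k, 'w::ab_group_add) vspace"
  assumes t: "t \<in> carr (V \<otimes> W)"
    and zero: "P 0"
    and step: "\<And>c v w s. v \<in> carr V \<Longrightarrow> w \<in> carr W \<Longrightarrow> s \<in> carr (V \<otimes> W) \<Longrightarrow> P s \<Longrightarrow>
                 P (smul_fun c (tens V W v w) + s)"
  shows "P t"
proof -
  interpret vector_space "smul_fun :: 'k \<Rightarrow> (('v \<Rightarrow> 'w \<Rightarrow> 'k) \<Rightarrow> 'k) \<Rightarrow> ('v \<Rightarrow> 'w \<Rightarrow> 'k) \<Rightarrow> 'k"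
    by (rule vector_space_smul_fun)
  have "t \<in> span {tens V W v w |v w. v \<in> carr V \<and> w \<in> carr W}"
    using t by (simp add: tensor_def)
  then have "t \<in> carr (V \<otimes> W) \<and> P t"
  proof (induction rule: span_induct_alt)
    case base
    show ?case unfolding tensor_def vspace.simps using zero span_zero by blast
  next
    case (step c x y)
    then obtain v w where x: "x = tens V W v w" "v \<in> carr V" "w \<in> carr W" by blast
    have "smul_fun c x + y \<in> carr (V \<otimes> W)"
      using step x tens_in[OF x(2,3)] by (simp add: tensor_def span_add span_scale)
    then show ?case unfolding x(1) using assms(3)[OF x(2,3), of y c] step.IH by blast
  qed
  then show ?thesis by blast
qed

lemma tensor_universal:
  fixes V :: "('k::field, 'v::ab_group_add) vspace" and W :: "('k, 'w::ab_group_add) vspace"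
    and U :: "('k, 'u::ab_group_add) vspace"
  assumes V: "vspace V" and W: "vspace W" and U: "vspace U" and h: "bilin V W U h"
  shows "\<exists>f. lin (V \<otimes> W) U f \<and> (\<forall>v\<in>carr V. \<forall>w\<in>carr W. f (tens V W v w) = h v w)"
proof -
  interpret u: vector_space "smul U" using U by (simp add: vspace_def)
  interpret k: vector_space "(*) :: 'k \<Rightarrow> 'k \<Rightarrow> 'k" by unfold_locales (auto simp: algebra_simps)
  interpret p: vector_space_pair "smul U" "(*) :: 'k \<Rightarrow> 'k \<Rightarrow> 'k" by unfold_locales
  have sU: "u.subspace (carr U)" using U by (simp add: vspace_def)
  let ?lin = "Vector_Spaces.linear (smul U) ((*) :: 'k \<Rightarrow> 'k \<Rightarrow> 'k)"
  have sep: "u = u'" if eq: "\<And>\<phi>. ?lin \<phi> \<Longrightarrow> \<phi> u = \<phi> u'" for u u'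
  proof (rule ccontr)
    assume "u \<noteq> u'"
    then have "u.independent {u - u'}" by simp
    from p.linear_independent_extend[OF this, of "\<lambda>_. 1"]
    obtain \<phi> where \<phi>: "?lin \<phi>" "\<phi> (u - u') = 1" by auto
    with eq[OF \<phi>(1)] show False by (simp add: p.linear_diff)
  qed
  define R where "R t u \<longleftrightarrow> u \<in> carr U \<and> (\<forall>\<phi>. ?lin \<phi> \<longrightarrow> \<phi> u = t (\<lambda>v w. \<phi> (h v w)))" for t u
  have uniq: "u = u'" if "R t u" "R t u'" for t u u'
  proof (rule sep)
    fix \<phi> assume "?lin \<phi>"
    with that have "\<phi> u = t (\<lambda>v w. \<phi> (h v w))" "\<phi> u' = t (\<lambda>v w. \<phi> (h v w))"
      unfolding R_def by blast+
    then show "\<phi> u = \<phi> u'" by simp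
  qed
  have bil: "bilin V W scalars (\<lambda>v w. \<phi> (h v w))" if "?lin \<phi>" for \<phi>
    using h that by (auto simp: bilin_def lin_def scalars_def whole_def p.linear_add p.linear_scale)
  have R_tens: "R (tens V W v w) (h v w)" if "v \<in> carr V" "w \<in> carr W" for v w
    using that h bil by (auto simp: R_def tens_def bilin_def lin_def)
  have R_zero: "R 0 0"
    using sU by (auto simp: R_def u.subspace_0 p.linear_0)
  have R_add: "R (t + t') (u + u')" if "R t u" "R t' u'" for t u t' u'
    using that sU by (auto simp: R_def u.subspace_add p.linear_add)
  have R_smul: "R (smul_fun c t) (smul U c u)" if "R t u" for c t u
    using that sU by (auto simp: R_def u.subspace_scale p.linear_scale smul_fun_def)
  have ex: "\<exists>u. R t u" if "t \<in> carr (V \<otimes> W)" for t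
    using that
  proof (induction rule: tensor_induct)
    case zero
    then show ?case using R_zero by blast
  next
    case (step c v w s)
    then show ?case using R_add R_smul R_tens by blast
  qed
  define f where "f t = (THE u. R t u)" for t
  have fI: "f t = u" if "R t u" for t u
    unfolding f_def using that uniq by blast
  have Rf: "R t (f t)" if "t \<in> carr (V \<otimes> W)" for t
    using ex[OF that] fI by blast
  have "lin (V \<otimes> W) U f"
    unfolding lin_def
  proof (intro conjI ballI allI)
    show "f t \<in> carr U" if "t \<in> carr (V \<otimes> W)" for t
      using Rf[OF that] by (simp add: R_def)
    show "f (s + t) = f s + f t" if "s \<in> carr (V \<otimes> W)" "t \<in> carr (V \<otimes> W)" for s t
      using that by (intro fI R_add Rf)
    show "f (smul (V \<otimes> W) c t) = smul U c (f t)" if "t \<in> carr (V \<otimes> W)" for c t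
      using that fI[OF R_smul[OF Rf[OF that]]] by (simp add: tensor_def)
  qed
  moreover have "\<forall>v\<in>carr V. \<forall>w\<in>carr W. f (tens V W v w) = h v w"
    using fI R_tens by blast
  ultimately show ?thesis by blast
qed

lemma tensor_unique:
  assumes f: "lin (V \<otimes> W) U f" and g: "lin (V \<otimes> W) U g"
    and eq: "\<And>v w. v \<in> carr V \<Longrightarrow> w \<in> carr W \<Longrightarrow> f (tens V W v w) = g (tens V W v w)"
    and t: "t \<in> carr (V \<otimes> W)"
  shows "f t = g t"
proof -
  have m: "smul (V \<otimes> W) = smul_fun" by (simp add: tensor_def)
  have sub: "module.subspace smul_fun (carr (V \<otimes> W))"
    using vspace_tensor[of V W] by (simp add: vspace_def m)
  show ?thesis
    using t
  proof (induction rule: tensor_induct)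
    case zero
    have "0 \<in> carr (V \<otimes> W)" by (rule module.subspace_0[OF module_smul_fun sub])
    then have "f (0 + 0) = f 0 + f 0" "g (0 + 0) = g 0 + g 0" using f g unfolding lin_def by blast+
    then show ?case by (metis add_cancel_right_right)
  next
    case (step c v w s)
    let ?x = "tens V W v w"
    have x: "?x \<in> carr (V \<otimes> W)" using step by (intro tens_in)
    then have cx: "smul_fun c ?x \<in> carr (V \<otimes> W)"
      by (rule module.subspace_scale[OF module_smul_fun sub])
    have "f (smul_fun c ?x) = g (smul_fun c ?x)"
      using f g x eq[OF step(1,2)] by (simp add: lin_def m)
    moreover have "f (smul_fun c ?x + s) = f (smul_fun c ?x) + f s"
      "g (smul_fun c ?x + s) = g (smul_fun c ?x) + g s"
      using f g cx step(3) unfolding lin_def by blast+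
    ultimately show ?case using step(4) by metis
  qed
qed

lemma
  assumes "vspace V" "vspace W" "vspace U" "bilin V W U h"
  shows lin_tensor_lift: "lin (V \<otimes> W) U (tensor_lift V W U h)"
    and tensor_lift_tens:
      "v \<in> carr V \<Longrightarrow> w \<in> carr W \<Longrightarrow> tensor_lift V W U h (tens V W v w) = h v w"
  using someI_ex[OF tensor_universal[OF assms]] unfolding tensor_lift_def by blast+

lemma bilin_tens: "bilin V W (V \<otimes> W) (tens V W)"
proof -
  have m: "smul (V \<otimes> W) = smul_fun" by (simp add: tensor_def)
  have "\<beta> v (x + y) = \<beta> v x + \<beta> v y \<and> \<beta> v (smul W c x) = c * \<beta> v x"
    if "bilin V W scalars \<beta>" "v \<in> carr V" "x \<in> carr W" "y \<in> carr W" for \<beta> v x y c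
    using that by (auto simp: bilin_def lin_def scalars_def whole_def)
  moreover have "\<beta> (x + y) w = \<beta> x w + \<beta> y w \<and> \<beta> (smul V c x) w = c * \<beta> x w"
    if "bilin V W scalars \<beta>" "w \<in> carr W" "x \<in> carr V" "y \<in> carr V" for \<beta> w x y c
    using that by (auto simp: bilin_def lin_def scalars_def whole_def)
  ultimately show ?thesis
    unfolding bilin_def[of V W "V \<otimes> W"] lin_def m
    by (auto simp: tens_in) (auto simp: fun_eq_iff tens_def smul_fun_def)
qed

text \<open>The maps \<open>f \<otimes> g\<close>, \<open>\<tau>\<close> and \<open>(u \<otimes> v) \<otimes> w \<mapsto> u \<otimes> (v \<otimes> w)\<close>.\<close>

definition tensor_map :: "('k::field, 'v::ab_group_add) vspace \<Rightarrow> ('k, 'w::ab_group_add) vspace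
    \<Rightarrow> ('k, 'v2::ab_group_add) vspace \<Rightarrow> ('k, 'w2::ab_group_add) vspace
    \<Rightarrow> ('v \<Rightarrow> 'v2) \<Rightarrow> ('w \<Rightarrow> 'w2)
    \<Rightarrow> (('v \<Rightarrow> 'w \<Rightarrow> 'k) \<Rightarrow> 'k) \<Rightarrow> ('v2 \<Rightarrow> 'w2 \<Rightarrow> 'k) \<Rightarrow> 'k" where
  "tensor_map V W V' W' f g = tensor_lift V W (V' \<otimes> W') (\<lambda>v w. tens V' W' (f v) (g w))"

definition flip :: "('k::field, 'v::ab_group_add) vspace \<Rightarrow> ('k, 'w::ab_group_add) vspace
    \<Rightarrow> (('v \<Rightarrow> 'w \<Rightarrow> 'k) \<Rightarrow> 'k) \<Rightarrow> ('w \<Rightarrow> 'v \<Rightarrow> 'k) \<Rightarrow> 'k" where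
  "flip V W = tensor_lift V W (W \<otimes> V) (\<lambda>v w. tens W V w v)"

definition assoc :: "('k::field, 'u::ab_group_add) vspace \<Rightarrow> ('k, 'v::ab_group_add) vspace
    \<Rightarrow> ('k, 'w::ab_group_add) vspace
    \<Rightarrow> (((('u \<Rightarrow> 'v \<Rightarrow> 'k) \<Rightarrow> 'k) \<Rightarrow> 'w \<Rightarrow> 'k) \<Rightarrow> 'k)
    \<Rightarrow> ('u \<Rightarrow> (('v \<Rightarrow> 'w \<Rightarrow> 'k) \<Rightarrow> 'k) \<Rightarrow> 'k) \<Rightarrow> 'k" where
  "assoc U V W = tensor_lift (U \<otimes> V) W (U \<otimes> V \<otimes> W)
     (\<lambda>t w. tensor_lift U V (U \<otimes> V \<otimes> W) (\<lambda>u v. tens U (V \<otimes> W) u (tens V W v w)) t)"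

text \<open>
  For a bilinear \<open>h\<close>, the Sweedler sum \<open>\<Sum> h x\<^sub>1 x\<^sub>2\<close> is the value of the linear map induced by \<open>h\<close>
  at \<open>\<Delta> x\<close>.
\<close>

abbreviation sweedler :: "('k::field, 'a::ab_group_add) vspace \<Rightarrow> ('k, 'u::ab_group_add) vspace
    \<Rightarrow> ('a \<Rightarrow> 'a \<Rightarrow> 'u) \<Rightarrow> (('a \<Rightarrow> 'a \<Rightarrow> 'k) \<Rightarrow> 'k) \<Rightarrow> 'u" where
  "sweedler A U h t \<equiv> tensor_lift A A U h t"

definition hom_bialgebra :: "('k::field, 'a::ab_group_add) vspace
    \<Rightarrow> ((('a \<Rightarrow> 'a \<Rightarrow> 'k) \<Rightarrow> 'k) \<Rightarrow> 'a) \<Rightarrow> ('a \<Rightarrow> ('a \<Rightarrow> 'a \<Rightarrow> 'k) \<Rightarrow> 'k) \<Rightarrow> ('a \<Rightarrow> 'a) \<Rightarrow> bool" where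
  "hom_bialgebra A \<mu> \<Delta> \<alpha> \<longleftrightarrow>
     vspace A \<and> lin (A \<otimes> A) A \<mu> \<and> lin A (A \<otimes> A) \<Delta> \<and> lin A A \<alpha> \<and>
     (\<forall>t\<in>carr (A \<otimes> A). \<alpha> (\<mu> t) = \<mu> (tensor_map A A A A \<alpha> \<alpha> t)) \<and>
     (\<forall>t\<in>carr ((A \<otimes> A) \<otimes> A).
        \<mu> (tensor_map A (A \<otimes> A) A A \<alpha> \<mu> (assoc A A A t)) =
        \<mu> (tensor_map (A \<otimes> A) A A A \<mu> \<alpha> t)) \<and>
     (\<forall>x\<in>carr A. tensor_map A A A A \<alpha> \<alpha> (\<Delta> x) = \<Delta> (\<alpha> x)) \<and>
     (\<forall>x\<in>carr A.
        tensor_map A A A (A \<otimes> A) \<alpha> \<Delta> (\<Delta> x) =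
        assoc A A A (tensor_map A A (A \<otimes> A) A \<Delta> \<alpha> (\<Delta> x))) \<and>
     (\<forall>a\<in>carr A. \<forall>b\<in>carr A.
        \<Delta> (\<mu> (tens A A a b)) =
        sweedler A (A \<otimes> A) (\<lambda>a1 a2.
          sweedler A (A \<otimes> A) (\<lambda>b1 b2. tens A A (\<mu> (tens A A a1 b1)) (\<mu> (tens A A a2 b2)))
            (\<Delta> b))
          (\<Delta> a))"

text \<open>
  The canonical map \<open>V\<^sup>* \<otimes> W\<^sup>* \<rightarrow> (V \<otimes> W)\<^sup>*\<close> with
  \<open>\<langle>\<phi> \<otimes> \<psi>, v \<otimes> w\<rangle> = \<langle>\<phi>, v\<rangle> \<langle>\<psi>, w\<rangle>\<close>. It is bijective when \<open>V\<close> and \<open>W\<close> are finite dimensional.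
\<close>

definition pairing :: "('k::field, 'v::ab_group_add) vspace \<Rightarrow> ('k, 'w::ab_group_add) vspace
    \<Rightarrow> ((('v \<Rightarrow> 'k) \<Rightarrow> ('w \<Rightarrow> 'k) \<Rightarrow> 'k) \<Rightarrow> 'k) \<Rightarrow> (('v \<Rightarrow> 'w \<Rightarrow> 'k) \<Rightarrow> 'k) \<Rightarrow> 'k" where
  "pairing V W = tensor_lift (dual V) (dual W) (dual (V \<otimes> W))
     (\<lambda>\<phi> \<psi> t. if t \<in> carr (V \<otimes> W) then tensor_lift V W scalars (\<lambda>v w. \<phi> v * \<psi> w) t else 0)"

definition comult_dual :: "('k::field, 'a::ab_group_add) vspace
    \<Rightarrow> ('a \<Rightarrow> ('a \<Rightarrow> 'a \<Rightarrow> 'k) \<Rightarrow> 'k)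
    \<Rightarrow> ((('a \<Rightarrow> 'k) \<Rightarrow> ('a \<Rightarrow> 'k) \<Rightarrow> 'k) \<Rightarrow> 'k) \<Rightarrow> 'a \<Rightarrow> 'k" where
  "comult_dual A \<Delta> s = (\<lambda>x. pairing A A s (\<Delta> x))"

text \<open>Meaningful only for finite-dimensional \<open>A\<close>, where the tensor exists and is unique.\<close>

definition mult_dual :: "('k::field, 'a::ab_group_add) vspace
    \<Rightarrow> ((('a \<Rightarrow> 'a \<Rightarrow> 'k) \<Rightarrow> 'k) \<Rightarrow> 'a)
    \<Rightarrow> ('a \<Rightarrow> 'k) \<Rightarrow> (('a \<Rightarrow> 'k) \<Rightarrow> ('a \<Rightarrow> 'k) \<Rightarrow> 'k) \<Rightarrow> 'k" where
  "mult_dual A \<mu> \<phi> = (THE s. s \<in> carr (dual A \<otimes> dual A) \<and>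
     (\<forall>x\<in>carr A. \<forall>y\<in>carr A. pairing A A s (tens A A x y) = \<phi> (\<mu> (tens A A x y))))"

lemma bilin_dual_form:
  "\<phi> \<in> carr (dual V) \<Longrightarrow> \<psi> \<in> carr (dual W) \<Longrightarrow> bilin V W scalars (\<lambda>v w. \<phi> v * \<psi> w)"
  by (auto simp: bilin_def dual_def lin_def scalars_def whole_def algebra_simps)

lemma bilin_pairing:
  assumes V: "vspace V" and W: "vspace W"
  shows "bilin (dual V) (dual W) (dual (V \<otimes> W))
    (\<lambda>\<phi> \<psi> t. if t \<in> carr (V \<otimes> W) then tensor_lift V W scalars (\<lambda>v w. \<phi> v * \<psi> w) t else 0)"
proof -
  let ?L = "\<lambda>\<phi> \<psi>. tensor_lift V W scalars (\<lambda>v w. \<phi> v * \<psi> w)"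
  let ?h = "\<lambda>\<phi> \<psi> t. if t \<in> carr (V \<otimes> W) then ?L \<phi> \<psi> t else 0"
  note L = lin_tensor_lift[OF V W vspace_scalars bilin_dual_form]
  note Lt = tensor_lift_tens[OF V W vspace_scalars bilin_dual_form]
  have dV: "a + b \<in> carr (dual V)" "smul (dual V) c a \<in> carr (dual V)"
    if "a \<in> carr (dual V)" "b \<in> carr (dual V)" for a b c
    using that by (auto intro: vspace_add vspace_smul vspace_dual)
  have dW: "a + b \<in> carr (dual W)" "smul (dual W) c a \<in> carr (dual W)"
    if "a \<in> carr (dual W)" "b \<in> carr (dual W)" for a b c
    using that by (auto intro: vspace_add vspace_smul vspace_dual)
  have sc: "smul (dual V) c a = smul_fun c a" "smul (dual W) c b = smul_fun c b"
    "smul (dual (V \<otimes> W)) c e = smul_fun c e" for a b c e by (simp_all add: dual_def)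
  have lin_add: "lin (V \<otimes> W) scalars (\<lambda>t. f t + g t)"
    and lin_smul: "lin (V \<otimes> W) scalars (\<lambda>t. c * f t)"
    if "lin (V \<otimes> W) scalars f" "lin (V \<otimes> W) scalars g" for f g c
    using that by (auto simp: lin_def scalars_def whole_def algebra_simps)
  show "bilin (dual V) (dual W) (dual (V \<otimes> W)) ?h"
    unfolding bilin_def
  proof (intro conjI ballI)
    fix \<phi> assume \<phi>: "\<phi> \<in> carr (dual V)"
    show "lin (dual W) (dual (V \<otimes> W)) (?h \<phi>)"
      unfolding lin_def
    proof (intro conjI ballI allI)
      fix \<psi> assume \<psi>: "\<psi> \<in> carr (dual W)"
      show "?h \<phi> \<psi> \<in> carr (dual (V \<otimes> W))"
        using L[OF \<phi> \<psi>] vspace_add[OF vspace_tensor[of V W]] vspace_smul[OF vspace_tensor[of V W]]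
        by (simp add: dual_def lin_def)
      show "?h \<phi> (smul (dual W) c \<psi>) = smul (dual (V \<otimes> W)) c (?h \<phi> \<psi>)" for c
      proof -
        have "?L \<phi> (smul (dual W) c \<psi>) t = c * ?L \<phi> \<psi> t" if "t \<in> carr (V \<otimes> W)" for t
          by (rule tensor_unique[OF L[OF \<phi> dW(2)[OF \<psi> \<psi>]] lin_smul[OF L[OF \<phi> \<psi>] L[OF \<phi> \<psi>]]
                _ that]) (simp add: Lt[OF \<phi> dW(2)[OF \<psi> \<psi>]] Lt[OF \<phi> \<psi>], simp add: sc smul_fun_def)
        then show ?thesis by (auto simp: fun_eq_iff sc(3) smul_fun_def)
      qed
      fix \<psi>' assume \<psi>': "\<psi>' \<in> carr (dual W)"
      have "?L \<phi> (\<psi> + \<psi>') t = ?L \<phi> \<psi> t + ?L \<phi> \<psi>' t" if "t \<in> carr (V \<otimes> W)" for t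
        by (rule tensor_unique[OF L[OF \<phi> dW(1)[OF \<psi> \<psi>']] lin_add[OF L[OF \<phi> \<psi>] L[OF \<phi> \<psi>']]
              _ that])
          (simp only: Lt[OF \<phi> dW(1)[OF \<psi> \<psi>']] Lt[OF \<phi> \<psi>] Lt[OF \<phi> \<psi>'], simp add: algebra_simps)
      then show "?h \<phi> (\<psi> + \<psi>') = ?h \<phi> \<psi> + ?h \<phi> \<psi>'" by (auto simp: fun_eq_iff)
    qed
  next
    fix \<psi> assume \<psi>: "\<psi> \<in> carr (dual W)"
    show "lin (dual V) (dual (V \<otimes> W)) (\<lambda>\<phi>. ?h \<phi> \<psi>)"
      unfolding lin_def
    proof (intro conjI ballI allI)
      fix \<phi> assume \<phi>: "\<phi> \<in> carr (dual V)"
      show "?h \<phi> \<psi> \<in> carr (dual (V \<otimes> W))"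
        using L[OF \<phi> \<psi>] vspace_add[OF vspace_tensor[of V W]] vspace_smul[OF vspace_tensor[of V W]]
        by (simp add: dual_def lin_def)
      show "?h (smul (dual V) c \<phi>) \<psi> = smul (dual (V \<otimes> W)) c (?h \<phi> \<psi>)" for c
      proof -
        have "?L (smul (dual V) c \<phi>) \<psi> t = c * ?L \<phi> \<psi> t" if "t \<in> carr (V \<otimes> W)" for t
          by (rule tensor_unique[OF L[OF dV(2)[OF \<phi> \<phi>] \<psi>] lin_smul[OF L[OF \<phi> \<psi>] L[OF \<phi> \<psi>]]
                _ that]) (simp add: Lt[OF dV(2)[OF \<phi> \<phi>] \<psi>] Lt[OF \<phi> \<psi>], simp add: sc smul_fun_def)
        then show ?thesis by (auto simp: fun_eq_iff sc(3) smul_fun_def)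
      qed
      fix \<phi>' assume \<phi>': "\<phi>' \<in> carr (dual V)"
      have "?L (\<phi> + \<phi>') \<psi> t = ?L \<phi> \<psi> t + ?L \<phi>' \<psi> t" if "t \<in> carr (V \<otimes> W)" for t
        by (rule tensor_unique[OF L[OF dV(1)[OF \<phi> \<phi>'] \<psi>] lin_add[OF L[OF \<phi> \<psi>] L[OF \<phi>' \<psi>]]
              _ that])
          (simp only: Lt[OF dV(1)[OF \<phi> \<phi>'] \<psi>] Lt[OF \<phi> \<psi>] Lt[OF \<phi>' \<psi>], simp add: algebra_simps)
      then show "?h (\<phi> + \<phi>') \<psi> = ?h \<phi> \<psi> + ?h \<phi>' \<psi>" by (auto simp: fun_eq_iff)
    qed
  qed
qed

lemma pairing_tens:
  assumes V: "vspace V" and W: "vspace W"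
    and mem: "\<phi> \<in> carr (dual V)" "\<psi> \<in> carr (dual W)" "v \<in> carr V" "w \<in> carr W"
  shows "pairing V W (tens (dual V) (dual W) \<phi> \<psi>) (tens V W v w) = \<phi> v * \<psi> w"
  using tensor_lift_tens[OF vspace_dual vspace_dual vspace_dual bilin_pairing[OF V W] mem(1,2)]
    tensor_lift_tens[OF V W vspace_scalars bilin_dual_form[OF mem(1,2)] mem(3,4)]
  by (simp add: pairing_def tens_in mem)

end

theory Submission
  imports Defs
begin

text \<open>
  All three statements say that one trilinear identity holds. Writing \<open>xy\<close> for \<open>\<mu> (x \<otimes> y)\<close>, it is
  \<open>R (\<alpha> x \<otimes> yz) = \<Sum> R (x\<^sub>1 \<otimes> \<alpha> z) R (x\<^sub>2 \<otimes> \<alpha> y)\<close>, and the statements differ only in which of the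
  variables are kept as arguments of functionals.

  In (2), \<open>y \<otimes> z\<close> is the argument of the map and \<open>x\<close> is where the resulting functional is
  evaluated. Both sides of (2), evaluated at a fixed \<open>x\<close>, are linear in the tensor, so (2) may be
  tested on pure tensors \<open>y \<otimes> z\<close>; there the opposite in \<open>\<Delta>\<^sup>*\<^sup>o\<^sup>p\<close> puts \<open>\<pi>\<^sub>1 z\<close> in front of \<open>\<pi>\<^sub>1 y\<close>, and
  pairing with \<open>\<Delta> x\<close> gives the Sweedler sum of (1) (\<open>comult_dual_flip_tens\<close>).

  In (3), \<open>x\<close> is the argument of the map and the result lies in \<open>A\<^sup>* \<otimes> A\<^sup>*\<close>. For finite-dimensional
  \<open>A\<close>, an element of \<open>A\<^sup>* \<otimes> A\<^sup>*\<close> is the same as a bilinear form on \<open>A\<close>: a dual basis \<open>e\<close> expands a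
  tensor with coefficients its values on pairs of basis vectors, and the same formula produces a
  tensor from a bilinear form (\<open>pairing_bijective\<close>). Hence (3) may be tested by pairing with all
  \<open>y \<otimes> z\<close>, which again gives (1) (\<open>pairing_tensor_map_flip\<close>).
\<close>

section \<open>Linear maps\<close>

lemma vspace_zero: "vspace V \<Longrightarrow> 0 \<in> carr V"
  unfolding vspace_def module_iff_vector_space[symmetric] by (blast intro: module.subspace_0)

lemma vspace_sum: "vspace V \<Longrightarrow> (\<And>i. i \<in> I \<Longrightarrow> x i \<in> carr V) \<Longrightarrow> (\<Sum>i\<in>I. x i) \<in> carr V"
  unfolding vspace_def module_iff_vector_space[symmetric] by (blast intro: module.subspace_sum)

lemma lin_zero:
  assumes "vspace V" "lin V W f"
  shows "f 0 = 0"
proof -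
  have "f (0 + 0) = f 0 + f 0"
    using assms vspace_zero unfolding lin_def by blast
  then show ?thesis by simp
qed

lemma lin_lincomb:
  assumes V: "vspace V" and f: "lin V W f" and x: "\<And>i. i \<in> I \<Longrightarrow> x i \<in> carr V"
  shows "f (\<Sum>i\<in>I. smul V (c i) (x i)) = (\<Sum>i\<in>I. smul W (c i) (f (x i)))"
  using x
proof (induction I rule: infinite_finite_induct)
  case (insert i I)
  have s: "smul V (c i) (x i) \<in> carr V" "(\<Sum>i\<in>I. smul V (c i) (x i)) \<in> carr V"
    using insert.prems by (auto intro: V vspace_smul vspace_sum)
  have "f (smul V (c i) (x i) + (\<Sum>i\<in>I. smul V (c i) (x i))) =
      f (smul V (c i) (x i)) + f (\<Sum>i\<in>I. smul V (c i) (x i))"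
    using f s unfolding lin_def by blast
  moreover have "f (smul V (c i) (x i)) = smul W (c i) (f (x i))"
    using f insert.prems unfolding lin_def by blast
  ultimately show ?case using insert by simp
qed (simp_all add: lin_zero[OF V f])

lemma lin_compose: "lin V W f \<Longrightarrow> lin W U g \<Longrightarrow> lin V U (\<lambda>x. g (f x))"
  by (simp add: lin_def)

lemma lin_id: "lin V V (\<lambda>x. x)"
  by (simp add: lin_def)

lemma smul_simps [simp]:
  "smul (V \<otimes> W) = smul_fun" "smul (dual V) = smul_fun" "smul scalars = (*)" "carr scalars = UNIV"
  by (simp_all add: tensor_def dual_def scalars_def whole_def)

lemma lin_eval_dual: "lin (dual V) scalars (\<lambda>\<phi>. \<phi> v)"
  by (simp add: lin_def smul_fun_def)

lemma lin_dual: "\<phi> \<in> carr (dual V) \<Longrightarrow> lin V scalars \<phi>"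
  by (simp add: dual_def)

lemma bilin_lin_left: "bilin V W U h \<Longrightarrow> w \<in> carr W \<Longrightarrow> lin V U (\<lambda>v. h v w)"
  and bilin_lin_right: "bilin V W U h \<Longrightarrow> v \<in> carr V \<Longrightarrow> lin W U (h v)"
  by (simp_all add: bilin_def)

lemma bilin_compose:
  assumes f: "lin V V' f" and g: "lin W W' g" and h: "bilin V' W' U h"
  shows "bilin V W U (\<lambda>v w. h (f v) (g w))"
proof -
  have "f v \<in> carr V'" "g w \<in> carr W'" if "v \<in> carr V" "w \<in> carr W" for v w
    using that f g by (auto simp: lin_def)
  moreover have "f v \<in> carr V'" if "v \<in> carr V" for v using that f by (auto simp: lin_def)
  moreover have "g w \<in> carr W'" if "w \<in> carr W" for w using that g by (auto simp: lin_def)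
  ultimately show ?thesis
    unfolding bilin_def
    by (auto intro: lin_compose[OF g bilin_lin_right[OF h]] lin_compose[OF f bilin_lin_left[OF h]])
qed

lemma bilin_then_lin:
  assumes h: "bilin V W T h" and f: "lin T U f"
  shows "bilin V W U (\<lambda>v w. f (h v w))"
  unfolding bilin_def
  by (auto intro: lin_compose[OF bilin_lin_right[OF h] f] lin_compose[OF bilin_lin_left[OF h] f])

section \<open>Maps between tensor products\<close>

lemma
  assumes V: "vspace V" and W: "vspace W" and f: "lin V V' f" and g: "lin W W' g"
  shows lin_tensor_map: "lin (V \<otimes> W) (V' \<otimes> W') (tensor_map V W V' W' f g)"
    and tensor_map_tens: "v \<in> carr V \<Longrightarrow> w \<in> carr W \<Longrightarrow>
      tensor_map V W V' W' f g (tens V W v w) = tens V' W' (f v) (g w)"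
  using lin_tensor_lift[OF V W vspace_tensor bilin_compose[OF f g bilin_tens]]
    tensor_lift_tens[OF V W vspace_tensor bilin_compose[OF f g bilin_tens]]
  by (simp_all add: tensor_map_def)

lemma bilin_tens_flip: "bilin V W (W \<otimes> V) (\<lambda>v w. tens W V w v)"
  using bilin_tens[of W V] by (simp add: bilin_def)

lemma
  assumes V: "vspace V" and W: "vspace W"
  shows lin_flip: "lin (V \<otimes> W) (W \<otimes> V) (flip V W)"
    and flip_tens: "v \<in> carr V \<Longrightarrow> w \<in> carr W \<Longrightarrow> flip V W (tens V W v w) = tens W V w v"
  using lin_tensor_lift[OF V W vspace_tensor bilin_tens_flip]
    tensor_lift_tens[OF V W vspace_tensor bilin_tens_flip]
  by (simp_all add: flip_def)

lemma lin_pairing: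
  assumes "vspace V" "vspace W"
  shows "lin (dual V \<otimes> dual W) (dual (V \<otimes> W)) (pairing V W)"
  using lin_tensor_lift[OF vspace_dual vspace_dual vspace_dual bilin_pairing[OF assms]]
  by (simp add: pairing_def)

lemma lin_pairing_at:
  assumes "vspace V" "vspace W"
  shows "lin (dual V \<otimes> dual W) scalars (\<lambda>s. pairing V W s t)"
  by (rule lin_compose[OF lin_pairing[OF assms] lin_eval_dual])

lemma pairing_tens_lift:
  assumes "vspace V" "vspace W" "\<phi> \<in> carr (dual V)" "\<psi> \<in> carr (dual W)" "t \<in> carr (V \<otimes> W)"
  shows "pairing V W (tens (dual V) (dual W) \<phi> \<psi>) t = tensor_lift V W scalars (\<lambda>v w. \<phi> v * \<psi> w) t"
  using tensor_lift_tens[OF vspace_dual vspace_dual vspace_dual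
      bilin_pairing[OF assms(1,2)] assms(3,4)] assms(5)
  by (simp add: pairing_def)

section \<open>Tensors of functionals as bilinear forms\<close>

text \<open>
  The usual relation of a basis to its dual basis, stated by the expansion of vectors alone: both
  the expansion of functionals and that of bilinear forms follow from it by linearity.
\<close>

definition coordinate_system ::
  "('k::field, 'v::ab_group_add) vspace \<Rightarrow> 'v set \<Rightarrow> ('v \<Rightarrow> 'v \<Rightarrow> 'k) \<Rightarrow> bool" where
  "coordinate_system V B e \<longleftrightarrow> finite B \<and> B \<subseteq> carr V \<and> (\<forall>b\<in>B. e b \<in> carr (dual V)) \<and>
     (\<forall>v\<in>carr V. (\<Sum>b\<in>B. smul V (e b v) b) = v)"

lemma finite_dimensional_coordinate_system:
  assumes "finite_dimensional_vector_space scale B"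
  shows "coordinate_system (whole scale) B (\<lambda>b v. module.representation scale B v b)"
proof -
  interpret finite_dimensional_vector_space scale B by (rule assms)
  have "v \<in> span B" for v by (simp add: span_Basis)
  then show ?thesis
    using finite_Basis independent_Basis sum_representation_eq[OF independent_Basis _ finite_Basis]
    by (auto simp: coordinate_system_def whole_def dual_def lin_def scalars_def
        representation_add representation_scale)
qed

lemma sum_fun_apply: "(\<Sum>i\<in>I. f i) x = (\<Sum>i\<in>I. f i x)"
  by (induction I rule: infinite_finite_induct) simp_all

lemma functional_expansion:
  assumes V: "vspace V" and B: "coordinate_system V B e" and \<phi>: "\<phi> \<in> carr (dual V)"
  shows "(\<Sum>b\<in>B. smul_fun (\<phi> b) (e b)) = \<phi>"
proof
  fix v
  show "(\<Sum>b\<in>B. smul_fun (\<phi> b) (e b)) v = \<phi> v"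
  proof (cases "v \<in> carr V")
    case True
    have "\<phi> v = \<phi> (\<Sum>b\<in>B. smul V (e b v) b)"
      using B True by (simp add: coordinate_system_def)
    also have "\<dots> = (\<Sum>b\<in>B. e b v * \<phi> b)"
      using lin_lincomb[OF V lin_dual[OF \<phi>], of B "\<lambda>b. b" "\<lambda>b. e b v"] B
      by (simp add: coordinate_system_def subset_iff)
    finally show ?thesis by (simp add: sum_fun_apply smul_fun_def mult.commute)
  next
    case False
    \<comment> \<open>Elements of the dual vanish outside the carrier.\<close>
    then show ?thesis
      using B \<phi> by (simp add: coordinate_system_def dual_def sum_fun_apply smul_fun_def)
  qed
qed

lemma bilin_lincomb:
  assumes V: "vspace V" and W: "vspace W" and h: "bilin V W U h"
    and x: "\<And>i. i \<in> I \<Longrightarrow> x i \<in> carr V" and y: "\<And>j. j \<in> J \<Longrightarrow> y j \<in> carr W"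
  shows "h (\<Sum>i\<in>I. smul V (c i) (x i)) (\<Sum>j\<in>J. smul W (d j) (y j)) =
    (\<Sum>i\<in>I. smul U (c i) (\<Sum>j\<in>J. smul U (d j) (h (x i) (y j))))"
proof -
  let ?y = "\<Sum>j\<in>J. smul W (d j) (y j)"
  have "?y \<in> carr W" by (auto intro: W y vspace_sum vspace_smul)
  from lin_lincomb[OF V bilin_lin_left[OF h this] x]
  have "h (\<Sum>i\<in>I. smul V (c i) (x i)) ?y = (\<Sum>i\<in>I. smul U (c i) (h (x i) ?y))" .
  then show ?thesis
    by (simp add: lin_lincomb[OF W bilin_lin_right[OF h x] y])
qed

text \<open>
  The tensor of a bilinear form \<open>\<beta>\<close>: the candidate inverse of the canonical map
  \<open>V\<^sup>* \<otimes> W\<^sup>* \<rightarrow> (V \<otimes> W)\<^sup>*\<close>.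
\<close>

definition form_tensor where
  "form_tensor V W B e C f \<beta> =
    (\<Sum>b\<in>B. \<Sum>c\<in>C. smul_fun (\<beta> b c) (tens (dual V) (dual W) (e b) (f c)))"

lemma form_tensor_in:
  assumes "coordinate_system V B e" and "coordinate_system W C f"
  shows "form_tensor V W B e C f \<beta> \<in> carr (dual V \<otimes> dual W)"
proof -
  have "smul_fun a (tens (dual V) (dual W) (e b) (f c)) \<in> carr (dual V \<otimes> dual W)"
    if "b \<in> B" "c \<in> C" for a b c
    using vspace_smul[OF vspace_tensor tens_in, of "e b" "dual V" "f c" "dual W" a] assms that
    by (simp add: coordinate_system_def)
  then show ?thesis unfolding form_tensor_def by (intro vspace_sum vspace_tensor)
qed

text \<open>
  Both sides are linear in \<open>s\<close>, and for \<open>s = \<phi> \<otimes> \<psi>\<close> the claim is the product of the expansions of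
  \<open>\<phi>\<close> and \<open>\<psi>\<close> in the coordinate functionals.
\<close>

lemma form_tensor_pairing:
  assumes V: "vspace V" and W: "vspace W"
    and B: "coordinate_system V B e" and C: "coordinate_system W C f"
    and s: "s \<in> carr (dual V \<otimes> dual W)"
  shows "form_tensor V W B e C f (\<lambda>v w. pairing V W s (tens V W v w)) = s"
proof (rule tensor_unique[OF _ lin_id _ s])
  let ?DT = "dual V \<otimes> dual W" and ?t = "tens (dual V) (dual W)"
  let ?g = "\<lambda>s. form_tensor V W B e C f (\<lambda>v w. pairing V W s (tens V W v w))"
  have BC: "b \<in> carr V" "c \<in> carr W" "e b \<in> carr (dual V)" "f c \<in> carr (dual W)"
    if "b \<in> B" "c \<in> C" for b c
    using B C that by (auto simp: coordinate_system_def)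
  have P: "pairing V W (s + s') t = pairing V W s t + pairing V W s' t"
    "pairing V W (smul_fun a s) t = a * pairing V W s t"
    if "s \<in> carr ?DT" "s' \<in> carr ?DT" for s s' t a
    using lin_pairing_at[OF V W, of t] that by (simp_all add: lin_def)
  show "lin ?DT ?DT ?g"
    unfolding lin_def
  proof (intro conjI ballI allI)
    fix s assume s: "s \<in> carr ?DT"
    show "?g s \<in> carr ?DT" by (rule form_tensor_in[OF B C])
    show "?g (smul ?DT a s) = smul ?DT a (?g s)" for a
      unfolding smul_simps P(2)[OF s s]
      by (simp add: form_tensor_def P[OF s s] fun_eq_iff sum_fun_apply smul_fun_def sum_distrib_left
          mult.assoc)
    show "?g (s + s') = ?g s + ?g s'" if "s' \<in> carr ?DT" for s'
      by (simp add: form_tensor_def P[OF s that] fun_eq_iff sum_fun_apply smul_fun_def sum.distrib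
          distrib_right)
  qed
  fix \<phi> \<psi> assume \<phi>: "\<phi> \<in> carr (dual V)" and \<psi>: "\<psi> \<in> carr (dual W)"
  have "?t \<phi> \<psi> = ?t (\<Sum>b\<in>B. smul_fun (\<phi> b) (e b)) (\<Sum>c\<in>C. smul_fun (\<psi> c) (f c))"
    by (simp add: functional_expansion[OF V B \<phi>] functional_expansion[OF W C \<psi>])
  also have "\<dots> = (\<Sum>b\<in>B. smul_fun (\<phi> b) (\<Sum>c\<in>C. smul_fun (\<psi> c) (?t (e b) (f c))))"
    using bilin_lincomb[OF vspace_dual vspace_dual bilin_tens[of "dual V" "dual W"],
        of B e C f \<phi> \<psi>] B C
    by (simp add: coordinate_system_def)
  also have "\<dots> = ?g (?t \<phi> \<psi>)"
    by (simp add: form_tensor_def pairing_tens[OF V W \<phi> \<psi> BC(1,2)] fun_eq_iff sum_fun_apply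
        smul_fun_def sum_distrib_left mult.assoc)
  finally show "?g (?t \<phi> \<psi>) = ?t \<phi> \<psi>" by simp
qed

text \<open>
  By linearity in the tensor, the left-hand side is \<open>\<Sum> \<beta> b c * e b v * f c w\<close>, which is \<open>\<beta>\<close> applied to
  the expansions of \<open>v\<close> and \<open>w\<close>.
\<close>

lemma pairing_form_tensor:
  assumes V: "vspace V" and W: "vspace W"
    and B: "coordinate_system V B e" and C: "coordinate_system W C f"
    and \<beta>: "bilin V W scalars \<beta>" and v: "v \<in> carr V" and w: "w \<in> carr W"
  shows "pairing V W (form_tensor V W B e C f \<beta>) (tens V W v w) = \<beta> v w"
proof -
  let ?DT = "dual V \<otimes> dual W" and ?t = "tens (dual V) (dual W)"
  have BC: "b \<in> carr V" "c \<in> carr W" "e b \<in> carr (dual V)" "f c \<in> carr (dual W)"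
    if "b \<in> B" "c \<in> C" for b c
    using B C that by (auto simp: coordinate_system_def)
  have T: "?t (e b) (f c) \<in> carr ?DT" if "b \<in> B" "c \<in> C" for b c
    using that by (intro tens_in BC)
  have "pairing V W (form_tensor V W B e C f \<beta>) (tens V W v w) =
      (\<Sum>p\<in>B \<times> C. \<beta> (fst p) (snd p) * pairing V W (?t (e (fst p)) (f (snd p))) (tens V W v w))"
    using lin_lincomb[OF vspace_tensor lin_pairing_at[OF V W], where I = "B \<times> C"
        and x = "\<lambda>p. ?t (e (fst p)) (f (snd p))" and c = "\<lambda>p. \<beta> (fst p) (snd p)"] T
    by (auto simp: form_tensor_def sum.cartesian_product case_prod_unfold)
  also have "\<dots> = (\<Sum>p\<in>B \<times> C. \<beta> (fst p) (snd p) * (e (fst p) v * f (snd p) w))"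
    by (rule sum.cong) (auto simp: pairing_tens[OF V W BC(3,4) v w])
  also have "\<dots> = (\<Sum>b\<in>B. e b v * (\<Sum>c\<in>C. f c w * \<beta> b c))"
    by (simp add: sum.cartesian_product' case_prod_unfold sum_distrib_left ac_simps)
  also have "\<dots> = \<beta> (\<Sum>b\<in>B. smul V (e b v) b) (\<Sum>c\<in>C. smul W (f c w) c)"
    using bilin_lincomb[OF V W \<beta>, of B "\<lambda>b. b" C "\<lambda>c. c" "\<lambda>b. e b v" "\<lambda>c. f c w"] B C
    by (simp add: coordinate_system_def subset_iff)
  also have "\<dots> = \<beta> v w"
    using B C v w by (simp add: coordinate_system_def)
  finally show "pairing V W (form_tensor V W B e C f \<beta>) (tens V W v w) = \<beta> v w" .
qed

text \<open>
  Existence is \<open>form_tensor\<close>; uniqueness holds because \<open>form_tensor_pairing\<close> recovers a tensor from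
  its pairings with pure tensors.
\<close>

lemma pairing_bijective:
  assumes V: "vspace V" and W: "vspace W"
    and B: "coordinate_system V B e" and C: "coordinate_system W C f"
    and \<beta>: "bilin V W scalars \<beta>"
  shows "\<exists>!s. s \<in> carr (dual V \<otimes> dual W) \<and>
    (\<forall>v\<in>carr V. \<forall>w\<in>carr W. pairing V W s (tens V W v w) = \<beta> v w)"
proof (rule ex1I[of _ "form_tensor V W B e C f \<beta>"])
  show "form_tensor V W B e C f \<beta> \<in> carr (dual V \<otimes> dual W) \<and>
      (\<forall>v\<in>carr V. \<forall>w\<in>carr W. pairing V W (form_tensor V W B e C f \<beta>) (tens V W v w) = \<beta> v w)"
    using form_tensor_in[OF B C] pairing_form_tensor[OF V W B C \<beta>] by blast
next
  fix s assume s: "s \<in> carr (dual V \<otimes> dual W) \<and>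
    (\<forall>v\<in>carr V. \<forall>w\<in>carr W. pairing V W s (tens V W v w) = \<beta> v w)"
  have "form_tensor V W B e C f (\<lambda>v w. pairing V W s (tens V W v w)) = form_tensor V W B e C f \<beta>"
    unfolding form_tensor_def
    using s B C by (intro sum.cong refl) (auto simp: coordinate_system_def subset_iff)
  then show "s = form_tensor V W B e C f \<beta>"
    using form_tensor_pairing[OF V W B C] s by simp
qed

text \<open>
  \<open>mult_dual\<close> is a definite description: an equation with it says nothing about the pairing unless
  exactly one tensor represents the form, and conversely the pairing determines the value only
  because that tensor is unique.
\<close>

lemma mult_dual_eq_iff:
  assumes A: "vspace A" and \<mu>: "lin (A \<otimes> A) A \<mu>" and \<phi>: "lin A scalars \<phi>"
    and B: "coordinate_system A B e" and s: "s \<in> carr (dual A \<otimes> dual A)"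
  shows "mult_dual A \<mu> \<phi> = s \<longleftrightarrow>
    (\<forall>y\<in>carr A. \<forall>z\<in>carr A. pairing A A s (tens A A y z) = \<phi> (\<mu> (tens A A y z)))"
proof -
  have "lin (A \<otimes> A) scalars (\<lambda>t. \<phi> (\<mu> t))" by (rule lin_compose[OF \<mu> \<phi>])
  then have "bilin A A scalars (\<lambda>y z. \<phi> (\<mu> (tens A A y z)))"
    by (rule bilin_then_lin[OF bilin_tens])
  from theI'[OF pairing_bijective[OF A A B B this]] pairing_bijective[OF A A B B this]
  show ?thesis unfolding mult_dual_def using s by blast
qed

section \<open>Both maps of functionals in terms of the coproduct\<close>

lemma comult_dual_flip_tens:
  assumes A: "vspace A" and p: "lin A (dual A) p"
    and x: "\<Delta> x \<in> carr (A \<otimes> A)" and y: "y \<in> carr A" and z: "z \<in> carr A"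
  shows "comult_dual A \<Delta>
      (flip (dual A) (dual A) (tensor_map A A (dual A) (dual A) p p (tens A A y z))) x =
    sweedler A scalars (\<lambda>x1 x2. p z x1 * p y x2) (\<Delta> x)"
proof -
  have "p y \<in> carr (dual A)" "p z \<in> carr (dual A)" using p y z by (auto simp: lin_def)
  then show ?thesis
    by (simp add: comult_dual_def tensor_map_tens[OF A A p p y z]
        flip_tens[OF vspace_dual vspace_dual] pairing_tens_lift[OF A A _ _ x])
qed

text \<open>Linearity in \<open>u\<close> reduces this to pure tensors, where \<open>\<tau>\<close> accounts for the crossing of \<open>y\<close> and \<open>z\<close>.\<close>

lemma pairing_tensor_map_flip:
  assumes A: "vspace A" and p: "lin A (dual A) p" and u: "u \<in> carr (A \<otimes> A)"
    and y: "y \<in> carr A" and z: "z \<in> carr A"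
  shows "pairing A A (tensor_map A A (dual A) (dual A) p p (flip A A u)) (tens A A y z) =
    sweedler A scalars (\<lambda>x1 x2. p x1 z * p x2 y) u"
proof (rule tensor_unique[OF _ _ _ u])
  show "lin (A \<otimes> A) scalars
      (\<lambda>u. pairing A A (tensor_map A A (dual A) (dual A) p p (flip A A u)) (tens A A y z))"
    using lin_compose[OF lin_compose[OF lin_flip[OF A A] lin_tensor_map[OF A A p p]]
        lin_pairing_at[OF A A]] .
  have "bilin scalars scalars scalars ((*) :: 'a \<Rightarrow> 'a \<Rightarrow> 'a)"
    by (simp add: bilin_def lin_def algebra_simps)
  from bilin_compose[OF lin_compose[OF p lin_eval_dual] lin_compose[OF p lin_eval_dual] this]
  have b: "bilin A A scalars (\<lambda>x1 x2. p x1 z * p x2 y)" .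
  show "lin (A \<otimes> A) scalars (sweedler A scalars (\<lambda>x1 x2. p x1 z * p x2 y))"
    by (rule lin_tensor_lift[OF A A vspace_scalars b])
  fix v w assume v: "v \<in> carr A" and w: "w \<in> carr A"
  have "p v \<in> carr (dual A)" "p w \<in> carr (dual A)" using p v w by (auto simp: lin_def)
  then show "pairing A A (tensor_map A A (dual A) (dual A) p p (flip A A (tens A A v w)))
      (tens A A y z) = sweedler A scalars (\<lambda>x1 x2. p x1 z * p x2 y) (tens A A v w)"
    using v w y z
    by (simp add: flip_tens[OF A A] tensor_map_tens[OF A A p p] pairing_tens[OF A A]
        tensor_lift_tens[OF A A vspace_scalars b])
qed

text \<open>
  The carrier has to be the whole type, since elements of the dual vanish outside the carrier and
  \<open>r x\<close> itself need not.
\<close>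

lemma lin_form_to_dual:
  assumes "bilin A A scalars r" and "carr A = UNIV"
  shows "lin A (dual A) r" and "lin A (dual A) (\<lambda>x v. r v x)"
  using assms by (simp_all add: bilin_def lin_def dual_def fun_eq_iff smul_fun_def)

section \<open>Equivalence of the three conditions on the bilinear form\<close>

theorem theorem2p9:
  fixes scale :: "'k::field_char_0 \<Rightarrow> 'a::ab_group_add \<Rightarrow> 'a"
    and A :: "('k, 'a) vspace"
    and \<mu> :: "(('a \<Rightarrow> 'a \<Rightarrow> 'k) \<Rightarrow> 'k) \<Rightarrow> 'a"
    and \<Delta> :: "'a \<Rightarrow> ('a \<Rightarrow> 'a \<Rightarrow> 'k) \<Rightarrow> 'k"
    and \<alpha> :: "'a \<Rightarrow> 'a"
    and R :: "(('a \<Rightarrow> 'a \<Rightarrow> 'k) \<Rightarrow> 'k) \<Rightarrow> 'k"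
    and \<pi>1 \<pi>1' \<pi>2 \<pi>2' :: "'a \<Rightarrow> 'a \<Rightarrow> 'k"
  assumes "vector_space scale" and "A = whole scale"
    and "hom_bialgebra A \<mu> \<Delta> \<alpha>"
    and "lin (A \<otimes> A) scalars R"
    and "\<pi>1 = (\<lambda>x v. R (tens A A v (\<alpha> x)))"
    and "\<pi>1' = (\<lambda>x v. R (tens A A (\<alpha> v) x))"
    and "\<pi>2 = (\<lambda>x v. R (tens A A (\<alpha> x) v))"
    and "\<pi>2' = (\<lambda>x v. R (tens A A x (\<alpha> v)))"
  shows "let
      stmt1 = (\<forall>x y z. R (tens A A (\<alpha> x) (\<mu> (tens A A y z))) =
        sweedler A scalars
          (\<lambda>x1 x2. R (tens A A x1 (\<alpha> z)) * R (tens A A x2 (\<alpha> y))) (\<Delta> x));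
      stmt2 = (\<forall>t\<in>carr (A \<otimes> A). \<pi>1' (\<mu> t) =
        comult_dual A \<Delta> (flip (dual A) (dual A) (tensor_map A A (dual A) (dual A) \<pi>1 \<pi>1 t)));
      stmt3 = (\<forall>x. mult_dual A \<mu> (\<pi>2 x) =
        tensor_map A A (dual A) (dual A) \<pi>2' \<pi>2' (flip A A (\<Delta> x)))
    in (stmt1 \<longleftrightarrow> stmt2) \<and>
       ((\<exists>B. finite_dimensional_vector_space scale B) \<longrightarrow>
          (stmt1 \<longleftrightarrow> stmt3) \<and> (stmt2 \<longleftrightarrow> stmt3))"
proof -
  note \<pi> = assms(5-8)
  have A: "vspace A" using assms(1,2) by (simp add: vspace_whole)
  have U [simp]: "carr A = UNIV" by (simp add: assms(2) whole_def)
  have \<mu>: "lin (A \<otimes> A) A \<mu>" and \<Delta>: "lin A (A \<otimes> A) \<Delta>" and \<alpha>: "lin A A \<alpha>"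
    using assms(3) by (simp_all add: hom_bialgebra_def)
  have \<Delta>_in: "\<Delta> x \<in> carr (A \<otimes> A)" for x using \<Delta> by (simp add: lin_def)
  have R: "bilin A A scalars (\<lambda>v w. R (tens A A v w))"
    by (rule bilin_then_lin[OF bilin_tens assms(4)])
  note R\<alpha> = bilin_compose[OF \<alpha> lin_id R] bilin_compose[OF lin_id \<alpha> R]
  have \<pi>1: "lin A (dual A) \<pi>1" and \<pi>1': "lin A (dual A) \<pi>1'"
    and \<pi>2: "lin A (dual A) \<pi>2" and \<pi>2': "lin A (dual A) \<pi>2'"
    using lin_form_to_dual[OF R\<alpha>(1)] lin_form_to_dual[OF R\<alpha>(2)] by (simp_all add: \<pi>)
  define stmt1 where "stmt1 \<longleftrightarrow> (\<forall>x y z. R (tens A A (\<alpha> x) (\<mu> (tens A A y z))) =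
    sweedler A scalars (\<lambda>x1 x2. R (tens A A x1 (\<alpha> z)) * R (tens A A x2 (\<alpha> y))) (\<Delta> x))"
  define stmt2 where "stmt2 \<longleftrightarrow> (\<forall>t\<in>carr (A \<otimes> A). \<pi>1' (\<mu> t) =
    comult_dual A \<Delta> (flip (dual A) (dual A) (tensor_map A A (dual A) (dual A) \<pi>1 \<pi>1 t)))"
  define stmt3 where "stmt3 \<longleftrightarrow> (\<forall>x. mult_dual A \<mu> (\<pi>2 x) =
    tensor_map A A (dual A) (dual A) \<pi>2' \<pi>2' (flip A A (\<Delta> x)))"
  let ?c = "\<lambda>t. comult_dual A \<Delta>
    (flip (dual A) (dual A) (tensor_map A A (dual A) (dual A) \<pi>1 \<pi>1 t))"
  have c: "?c (tens A A y z) x =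
      sweedler A scalars (\<lambda>x1 x2. R (tens A A x1 (\<alpha> z)) * R (tens A A x2 (\<alpha> y))) (\<Delta> x)" for x y z
    using comult_dual_flip_tens[where \<Delta> = \<Delta>, OF A \<pi>1 \<Delta>_in] by (simp add: \<pi>(1))
  have 12: "stmt1 \<longleftrightarrow> stmt2"
  proof
    assume 1: stmt1
    show stmt2
      unfolding stmt2_def
    proof (intro ballI ext)
      fix t x assume t: "t \<in> carr (A \<otimes> A)"
      show "\<pi>1' (\<mu> t) x = ?c t x"
      proof (rule tensor_unique[OF _ _ _ t])
        show "lin (A \<otimes> A) scalars (\<lambda>t. \<pi>1' (\<mu> t) x)"
          by (rule lin_compose[OF lin_compose[OF \<mu> \<pi>1'] lin_eval_dual])
        show "lin (A \<otimes> A) scalars (\<lambda>t. ?c t x)"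
          unfolding comult_dual_def
          using lin_compose[OF lin_compose[OF lin_tensor_map[OF A A \<pi>1 \<pi>1]
                lin_flip[OF vspace_dual vspace_dual]] lin_pairing_at[OF A A]] .
        show "\<pi>1' (\<mu> (tens A A y z)) x = ?c (tens A A y z) x" for y z
          using 1 by (simp add: c stmt1_def \<pi>(2))
      qed
    qed
  next
    assume 2: stmt2
    show stmt1
      unfolding stmt1_def
    proof (intro allI)
      fix x y z
      have "tens A A y z \<in> carr (A \<otimes> A)" by (simp add: tens_in)
      with 2 have "\<pi>1' (\<mu> (tens A A y z)) x = ?c (tens A A y z) x" by (simp add: stmt2_def)
      then show "R (tens A A (\<alpha> x) (\<mu> (tens A A y z))) =
          sweedler A scalars (\<lambda>x1 x2. R (tens A A x1 (\<alpha> z)) * R (tens A A x2 (\<alpha> y))) (\<Delta> x)"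
        by (simp add: c) (simp add: \<pi>(2))
    qed
  qed
  have 13: "stmt1 \<longleftrightarrow> stmt3" if fd: "finite_dimensional_vector_space scale B" for B
  proof -
    let ?s = "\<lambda>x. tensor_map A A (dual A) (dual A) \<pi>2' \<pi>2' (flip A A (\<Delta> x))"
    have s: "?s x \<in> carr (dual A \<otimes> dual A)" for x
      using lin_compose[OF lin_compose[OF \<Delta> lin_flip[OF A A]] lin_tensor_map[OF A A \<pi>2' \<pi>2']]
      by (simp add: lin_def)
    have \<phi>: "lin A scalars (\<pi>2 x)" for x using \<pi>2 by (simp add: lin_def[of A "dual A"] lin_dual)
    note B = finite_dimensional_coordinate_system[OF fd, folded assms(2)]
    have "pairing A A (?s x) (tens A A y z) =
        sweedler A scalars (\<lambda>x1 x2. R (tens A A x1 (\<alpha> z)) * R (tens A A x2 (\<alpha> y))) (\<Delta> x)" for x y z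
      using pairing_tensor_map_flip[OF A \<pi>2' \<Delta>_in, of y z x] by (simp add: \<pi>(4))
    then have "mult_dual A \<mu> (\<pi>2 x) = ?s x \<longleftrightarrow>
        (\<forall>y z. R (tens A A (\<alpha> x) (\<mu> (tens A A y z))) =
          sweedler A scalars (\<lambda>x1 x2. R (tens A A x1 (\<alpha> z)) * R (tens A A x2 (\<alpha> y))) (\<Delta> x))" for x
      by (simp add: mult_dual_eq_iff[OF A \<mu> \<phi> B s]) (auto simp: \<pi>(3))
    then show ?thesis by (simp add: stmt1_def stmt3_def)
  qed
  show ?thesis
    unfolding Let_def stmt1_def[symmetric] stmt2_def[symmetric] stmt3_def[symmetric]
    using 12 13 by blast
qed

end
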